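(* The recurrence coefficients of the Hahn polynomials, i.e. the monic polynomials $P_n(x)$ orthogonal with respect to the weight function $$\rho(x)=\frac{(a_1)_x(a_2)_x}{x!\,(b+1)_x},$$ with $b\neq-1,-2,\ldots$ and $$\operatorname{Re}(b-a_1-a_2)>0,\qquad b-a_1-a_2\neq1,2,\ldots,$$ are given by $$\beta_n=\frac{(b+2-a_1-a_2)a_1a_2-n(a_1+a_2+b)(n+a_1+a_2-b-1)}{(2n+a_1+a_2-b)(2n+a_1+a_2-b-2)},$$ and $$\gamma_n=-n\,\frac{(n+a_1-1)(n+a_2-1)(n+a_1-b-1)}{(2n+a_1+a_2-b-1)(2n+a_1+a_2-b-3)}\times\frac{(n+a_2-b-1)(n+a_1+a_2-b-2)}{(2n+a_1+a_2-b-2)^2}.$$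
   Context: $(a)_x$ denotes the Pochhammer symbol: $(a)_0=1$, $(a)_x=a(a+1)\cdots(a+x-1)$ for $x\in\mathbb{N}$. Orthogonality is with respect to the linear functional $L[f]=\sum_{x=0}^{\infty}f(x)\rho(x)$ on polynomials: $P_n$ is monic with $\deg P_n=n$, and $L[P_nP_m]=h_n\delta_{n,m}$ with $h_n\neq0$ for $n,m=0,1,\ldots$, where $\delta_{n,m}$ is Kronecker's delta. The recurrence coefficients $\beta_n,\gamma_n$ are those of the three-term recurrence relation $xP_n(x)=P_{n+1}(x)+\beta_nP_n(x)+\gamma_nP_{n-1}(x)$, with $P_{-1}=0$, $P_0=1$; that is, $\beta_n=L[xP_n^2]/h_n$, $\gamma_n=L[xP_nP_{n-1}]/h_{n-1}=h_n/h_{n-1}$ for $n\ge1$, and $\gamma_0=0$ by definition.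
   Formalization: The series L[f]=Σf(x)ρ(x) diverges for polynomials of large degree unless it terminates (then h_n=0 for large n); L is therefore read as the analytic continuation in b of this series to the stated parameter domain. *)

theory Defs
  imports "HOL-Complex_Analysis.Complex_Analysis" "HOL-Real_Asymp.Real_Asymp"
begin

definition hahn_weight :: "complex \<Rightarrow> complex \<Rightarrow> complex \<Rightarrow> nat \<Rightarrow> complex" where
  "hahn_weight a1 a2 b x =
     pochhammer a1 x * pochhammer a2 x / (fact x * pochhammer (b + 1) x)"

text \<open>
  Since \<open>hahn_weight a1 a2 b x\<close> decays like a power of \<open>x\<close> (with exponent \<open>a1 + a2 - b - 2\<close>) unless
  it terminates, the series \<open>L[f] = (\<Sum>x. f x * hahn_weight a1 a2 b x)\<close> diverges for every \<open>b\<close> once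
  \<open>degree f\<close> is large. As a functional on all polynomials, \<open>L\<close> is therefore read as the analytic
  continuation in \<open>b\<close>, from the part of the parameter domain where the series converges to the
  whole domain. The excluded values \<open>b - a1 - a2 = 1, 2, \<dots>\<close> are the poles of this continuation.
  Existence, uniqueness and agreement with the convergent series are shown in
  \<open>hahn_continuation_exists\<close>, \<open>hahn_continuation_unique\<close> and \<open>hahn_functional_eq_suminf\<close>.
\<close>

definition hahn_domain :: "complex \<Rightarrow> complex \<Rightarrow> complex set" where
  "hahn_domain a1 a2 = {b. (\<forall>k::nat. b \<noteq> - of_nat (Suc k)) \<and>
     0 < Re (b - a1 - a2) \<and> (\<forall>k::nat. b - a1 - a2 \<noteq> of_nat (Suc k))}"

definition hahn_continuation ::
  "complex \<Rightarrow> complex \<Rightarrow> complex poly \<Rightarrow> (complex \<Rightarrow> complex) \<Rightarrow> bool" where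
  "hahn_continuation a1 a2 f g \<longleftrightarrow>
     g holomorphic_on hahn_domain a1 a2 \<and>
     (\<forall>c\<in>hahn_domain a1 a2. real (degree f) < Re (c - a1 - a2) \<longrightarrow>
        (\<lambda>x. poly f (of_nat x) * hahn_weight a1 a2 c x) sums g c)"

definition hahn_functional :: "complex \<Rightarrow> complex \<Rightarrow> complex \<Rightarrow> complex poly \<Rightarrow> complex" where
  "hahn_functional a1 a2 b f = (THE v. \<exists>g. hahn_continuation a1 a2 f g \<and> v = g b)"

lemma open_hahn_domain: "open (hahn_domain a1 a2)"
proof -
  have c1: "closed ((\<lambda>k::nat. - of_nat (Suc k) :: complex) ` UNIV)"
    by (rule closed_subset_Ints) (auto simp del: of_nat_Suc)
  have c2: "closed ((\<lambda>k::nat. of_nat (Suc k) :: complex) ` UNIV)"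
    by (rule closed_subset_Ints) (auto simp del: of_nat_Suc)
  have c3: "closed ((+) (a1 + a2) ` ((\<lambda>k::nat. of_nat (Suc k) :: complex) ` UNIV))"
    by (intro closed_translation c2)
  have o: "open {b. 0 < Re (b - a1 - a2)}"
    by (intro open_Collect_less continuous_intros)
  have "hahn_domain a1 a2 = {b. 0 < Re (b - a1 - a2)} -
      (range (\<lambda>k::nat. - of_nat (Suc k) :: complex)) -
      (+) (a1 + a2) ` (range (\<lambda>k::nat. of_nat (Suc k) :: complex))"
    unfolding hahn_domain_def by (auto simp: algebra_simps image_iff simp del: of_nat_Suc)
  then show ?thesis using o c1 c3 by (simp add: open_Diff)
qed

lemma connected_hahn_domain: "connected (hahn_domain a1 a2)"
proof -
  let ?H = "{b. 0 < Re (b - a1 - a2)}"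
  let ?C = "range (\<lambda>k::nat. - of_nat (Suc k) :: complex) \<union>
      (+) (a1 + a2) ` (range (\<lambda>k::nat. of_nat (Suc k) :: complex))"
  have eq: "hahn_domain a1 a2 = ?H - ?C"
    unfolding hahn_domain_def by (auto simp: algebra_simps image_iff simp del: of_nat_Suc)
  have H: "?H = {b. Re b > Re (a1 + a2)}" by auto
  have "open ?H"
    by (intro open_Collect_less continuous_intros)
  moreover have "convex ?H" unfolding H by (rule convex_halfspace_Re_gt)
  ultimately show ?thesis unfolding eq
    by (intro connected_open_diff_countable) (auto simp: convex_connected)
qed

lemma pochhammer_hahn_domain:
  assumes "c \<in> hahn_domain a1 a2"
  shows "pochhammer (c + 1) n \<noteq> 0" "of_nat (Suc n) + c \<noteq> 0"
proof -
  show ne: "of_nat (Suc n) + c \<noteq> 0" for n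
    using assms unfolding hahn_domain_def
    by (metis (mono_tags, lifting) add_eq_0_iff mem_Collect_eq minus_minus)
  show "pochhammer (c + 1) n \<noteq> 0"
    using ne by (auto simp: pochhammer_eq_0_iff algebra_simps) (metis add_diff_cancel_left' diff_add_cancel ne of_nat_Suc add.commute add.assoc eq_neg_iff_add_eq_0)
qed

lemma hahn_weight_Suc:
  assumes "c \<in> hahn_domain a1 a2"
  shows "of_nat (Suc x) * (of_nat (Suc x) + c) * hahn_weight a1 a2 c (Suc x) =
    (of_nat x + a1) * (of_nat x + a2) * hahn_weight a1 a2 c x"
proof -
  have "pochhammer (c + 1) x \<noteq> 0" "of_nat (Suc x) + c \<noteq> 0" "(of_nat (Suc x) :: complex) \<noteq> 0"
    using pochhammer_hahn_domain[OF assms] by (auto simp del: of_nat_Suc)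
  then show ?thesis
    unfolding hahn_weight_def pochhammer_Suc fact_Suc
    by (simp add: divide_simps del: of_nat_Suc) (simp add: algebra_simps)
qed

lemma hahn_weight_holomorphic: "(\<lambda>c. hahn_weight a1 a2 c x) holomorphic_on hahn_domain a1 a2"
proof -
  have "(\<lambda>c. pochhammer (c + 1) x) holomorphic_on hahn_domain a1 a2"
    unfolding pochhammer_prod by (intro holomorphic_intros)
  then show ?thesis
    unfolding hahn_weight_def
    by (intro holomorphic_intros) (auto dest: pochhammer_hahn_domain)
qed

lemma hahn_weight_bound:
  assumes c0: "c0 \<in> hahn_domain a1 a2" and s: "s < Re (c0 - a1 - a2) + 2"
  obtains d K N where "d > 0" "cball c0 d \<subseteq> hahn_domain a1 a2"
    "\<And>c n. c \<in> cball c0 d \<Longrightarrow> n \<ge> N \<Longrightarrow> norm (hahn_weight a1 a2 c n) \<le> K * real n powr (-s)"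
proof -
  let ?w = "hahn_weight a1 a2"
  define e where "e = (Re (c0 - a1 - a2) + 2 - s) / 4"
  have e: "e > 0" using s by (simp add: e_def)
  obtain d0 where d0: "d0 > 0" "cball c0 d0 \<subseteq> hahn_domain a1 a2"
    using open_hahn_domain c0 open_contains_cball by blast
  define d where "d = min d0 e"
  have d: "d > 0" "d \<le> e" "cball c0 d \<subseteq> hahn_domain a1 a2"
    using d0 e by (auto simp: d_def)
  define r A B where "r = Re c0 - d" and "A = Re a1 + e" and "B = Re a2 + e"
  have rs: "s < r + 2 - A - B"
    using d e unfolding r_def A_def B_def e_def by (simp add: field_simps)
  have nrm: "\<forall>\<^sub>F n in sequentially. norm (of_nat n + a) \<le> real n + (Re a + e)" for a :: complex
  proof -
    have "Re a < Re a + e" using e by simp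
    then have "\<forall>\<^sub>F n in sequentially. sqrt ((real n + Re a)^2 + (Im a)^2) \<le> real n + (Re a + e)"
      by real_asymp
    then show ?thesis by (simp add: cmod_def)
  qed
  have ratio: "\<forall>\<^sub>F n in sequentially.
      (real n + A) * (real n + B) / ((real n + 1) * (real n + r + 1)) \<le> (real n / (real n + 1)) powr s"
    using rs by real_asymp
  have pos: "\<forall>\<^sub>F n in sequentially. real n + r + 1 > 0" "\<forall>\<^sub>F n in sequentially. n > (0::nat)"
    by real_asymp+
  have "\<forall>\<^sub>F n in sequentially. norm (of_nat n + a1) \<le> real n + A \<and>
      norm (of_nat n + a2) \<le> real n + B \<and> real n + r + 1 > 0 \<and> n > 0 \<and>
      (real n + A) * (real n + B) / ((real n + 1) * (real n + r + 1)) \<le> (real n / (real n + 1)) powr s"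
    using nrm[of a1] nrm[of a2] pos ratio unfolding A_def B_def
    by eventually_elim simp
  then obtain N where N: "\<And>n. n \<ge> N \<Longrightarrow> norm (of_nat n + a1) \<le> real n + A \<and>
      norm (of_nat n + a2) \<le> real n + B \<and> real n + r + 1 > 0 \<and> n > 0 \<and>
      (real n + A) * (real n + B) / ((real n + 1) * (real n + r + 1)) \<le> (real n / (real n + 1)) powr s"
    unfolding eventually_sequentially by blast
  have "continuous_on (cball c0 d) (\<lambda>c. ?w c N)"
    using hahn_weight_holomorphic d(3) holomorphic_on_imp_continuous_on holomorphic_on_subset by blast
  then have "bounded ((\<lambda>c. ?w c N) ` cball c0 d)"
    by (intro compact_imp_bounded compact_continuous_image) auto
  then obtain K0 where K0: "\<And>c. c \<in> cball c0 d \<Longrightarrow> norm (?w c N) \<le> K0"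
    unfolding bounded_iff by blast
  define K where "K = K0 * real N powr s"
  have "norm (?w c n) \<le> K * real n powr (-s)" if c: "c \<in> cball c0 d" and n: "n \<ge> N" for c n
    using n
  proof (induction n rule: dec_induct)
    case base
    then show ?case using K0[OF c] N[of N] by (simp add: K_def powr_minus field_simps)
  next
    case (step n)
    note Nn = N[OF step(1)]
    have Kn: "0 \<le> K * real n powr (-s)" using step.IH norm_ge_zero order_trans by blast
    have "\<bar>Re (c0 - c)\<bar> \<le> d" using c abs_Re_le_cmod[of "c0 - c"] by (simp add: dist_norm)
    then have "real n + r + 1 \<le> Re (of_nat (Suc n) + c)" by (simp add: r_def)
    then have den: "real n + r + 1 \<le> norm (of_nat (Suc n) + c)"
      using complex_Re_le_cmod order_trans by blast
    have cD: "c \<in> hahn_domain a1 a2" using c d(3) by blast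
    have sn: "norm (of_nat (Suc n) :: complex) = real n + 1" by (simp add: norm_of_nat del: of_nat_Suc)
    have "(real n + 1) * norm (of_nat (Suc n) + c) * norm (?w c (Suc n)) =
        norm (of_nat n + a1) * norm (of_nat n + a2) * norm (?w c n)"
      using arg_cong[OF hahn_weight_Suc[OF cD, of n], of norm] unfolding norm_mult sn by simp
    also have "\<dots> \<le> (real n + A) * (real n + B) * (K * real n powr (-s))"
      using Nn step.IH by (intro mult_mono mult_nonneg_nonneg) (auto intro: order_trans[OF norm_ge_zero])
    finally have "(real n + 1) * (real n + r + 1) * norm (?w c (Suc n)) \<le>
        (real n + A) * (real n + B) * (K * real n powr (-s))"
      using den by (smt (verit) mult_left_mono mult_right_mono norm_ge_zero of_nat_0_le_iff)
    then have "norm (?w c (Suc n)) \<le>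
        (real n + A) * (real n + B) / ((real n + 1) * (real n + r + 1)) * (K * real n powr (-s))"
      using Nn by (simp add: pos_le_divide_eq mult_ac)
    also have "\<dots> \<le> (real n / (real n + 1)) powr s * (K * real n powr (-s))"
      using Nn Kn by (intro mult_right_mono) auto
    also have "\<dots> = K * real (Suc n) powr (-s)"
      using Nn by (simp add: powr_divide powr_minus field_simps)
    finally show ?case .
  qed
  then show ?thesis using that d by blast
qed

lemma hahn_weight_decay:
  assumes c: "c \<in> hahn_domain a1 a2" and s: "s < Re (c - a1 - a2) + 2"
  obtains K N where "\<And>n. n \<ge> N \<Longrightarrow> n > 0 \<and>
    norm (of_nat n ^ k * hahn_weight a1 a2 c n) \<le> K * real n powr (real k - s)"
proof -
  obtain d K N where K: "d > 0" "\<And>c' n. c' \<in> cball c d \<Longrightarrow> n \<ge> N \<Longrightarrow>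
      norm (hahn_weight a1 a2 c' n) \<le> K * real n powr (-s)"
    using hahn_weight_bound[OF c s] by metis
  have "n > 0 \<and> norm (of_nat n ^ k * hahn_weight a1 a2 c n) \<le> K * real n powr (real k - s)"
    if n: "n \<ge> max 1 N" for n
  proof -
    have "norm (of_nat n ^ k * hahn_weight a1 a2 c n) = real n powr real k * norm (hahn_weight a1 a2 c n)"
      using n by (simp add: norm_mult norm_power powr_realpow)
    also have "\<dots> \<le> real n powr real k * (K * real n powr (-s))"
      using K(1) n by (intro mult_left_mono K(2)) auto
    also have "\<dots> = K * real n powr (real k - s)"
      by (simp add: powr_diff powr_minus field_simps)
    finally show ?thesis using n by simp
  qed
  then show ?thesis using that by blast
qed

lemma hahn_moment_summable:
  assumes c: "c \<in> hahn_domain a1 a2" and k: "real k < Re (c - a1 - a2) + 1"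
  shows "summable (\<lambda>x. of_nat x ^ k * hahn_weight a1 a2 c x)"
proof -
  obtain s where s: "real k + 1 < s" "s < Re (c - a1 - a2) + 2"
    using dense[of "real k + 1" "Re (c - a1 - a2) + 2"] k by auto
  obtain K N where K: "\<And>n. n \<ge> N \<Longrightarrow> n > 0 \<and>
      norm (of_nat n ^ k * hahn_weight a1 a2 c n) \<le> K * real n powr (real k - s)"
    using hahn_weight_decay[OF c s(2)] by metis
  have "summable (\<lambda>n. K * real n powr (real k - s))"
    using s by (intro summable_mult) (simp add: summable_real_powr_iff)
  then show ?thesis by (rule summable_comparison_test'[where N = N]) (use K in blast)
qed

lemma hahn_moment_tendsto_0:
  assumes c: "c \<in> hahn_domain a1 a2" and k: "real k < Re (c - a1 - a2) + 2"
  shows "(\<lambda>x. of_nat x ^ k * hahn_weight a1 a2 c x) \<longlonglongrightarrow> 0"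
proof -
  obtain s where s: "real k < s" "s < Re (c - a1 - a2) + 2"
    using dense[of "real k" "Re (c - a1 - a2) + 2"] k by auto
  obtain K N where K: "\<And>n. n \<ge> N \<Longrightarrow> n > 0 \<and>
      norm (of_nat n ^ k * hahn_weight a1 a2 c n) \<le> K * real n powr (real k - s)"
    using hahn_weight_decay[OF c s(2)] by metis
  have "real k - s < 0" using s by simp
  then have "(\<lambda>n. real n powr (real k - s)) \<longlonglongrightarrow> 0" by real_asymp
  then have "(\<lambda>n. K * real n powr (real k - s)) \<longlonglongrightarrow> 0" using tendsto_mult_right_zero by blast
  then show ?thesis
    by (rule Lim_null_comparison[rotated]) (use K in \<open>auto simp: eventually_sequentially\<close>)
qed

lemma hahn_mass_holomorphic:
  "(\<lambda>c. \<Sum>x. hahn_weight a1 a2 c x) holomorphic_on hahn_domain a1 a2"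
proof (rule holomorphic_uniform_sequence[OF open_hahn_domain])
  show "(\<lambda>c. \<Sum>x<n. hahn_weight a1 a2 c x) holomorphic_on hahn_domain a1 a2" for n
    by (intro holomorphic_intros hahn_weight_holomorphic)
  fix c0 assume c0: "c0 \<in> hahn_domain a1 a2"
  then have "0 < Re (c0 - a1 - a2)" by (simp add: hahn_domain_def)
  then obtain s where s: "1 < s" "s < Re (c0 - a1 - a2) + 2"
    using dense[of 1 "Re (c0 - a1 - a2) + 2"] by auto
  obtain d K N where d: "d > 0" "cball c0 d \<subseteq> hahn_domain a1 a2"
    and K: "\<And>c n. c \<in> cball c0 d \<Longrightarrow> n \<ge> N \<Longrightarrow>
      norm (hahn_weight a1 a2 c n) \<le> K * real n powr (-s)"
    using hahn_weight_bound[OF c0 s(2)] by metis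
  have "summable (\<lambda>n. K * real n powr (-s))"
    using s by (intro summable_mult) (simp add: summable_real_powr_iff)
  then have "uniform_limit (cball c0 d) (\<lambda>n c. \<Sum>x<n. hahn_weight a1 a2 c x)
      (\<lambda>c. \<Sum>x. hahn_weight a1 a2 c x) sequentially"
    by (rule Weierstrass_m_test_ev[rotated]) (use K in \<open>unfold eventually_sequentially, blast\<close>)
  with d show "\<exists>d>0. cball c0 d \<subseteq> hahn_domain a1 a2 \<and>
      uniform_limit (cball c0 d) (\<lambda>n c. \<Sum>x<n. hahn_weight a1 a2 c x)
      (\<lambda>c. \<Sum>x. hahn_weight a1 a2 c x) sequentially" by blast
qed

lemma hahn_moment_reduction:
  fixes a1 a2 :: complex
  shows "\<exists>R. degree R \<le> d \<and> (\<forall>x. (x + a1) * (x + a2) * (x + 1) ^ d =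
    x ^ (d + 2) + (a1 + a2 + of_nat d) * x ^ (d + 1) + poly R x)"
proof (induction d)
  case 0
  show ?case by (rule exI[of _ "[:a1 * a2:]"]) (simp add: algebra_simps power2_eq_square)
next
  case (Suc d)
  then obtain R where R: "degree R \<le> d" and eq: "\<And>x. (x + a1) * (x + a2) * (x + 1) ^ d =
    x ^ (d + 2) + (a1 + a2 + of_nat d) * x ^ (d + 1) + poly R x" by blast
  let ?R = "pCons 0 R + R + monom (a1 + a2 + of_nat d) (Suc d)"
  have "degree ?R \<le> Suc d"
    using R by (intro degree_add_le degree_monom_le) (auto intro: order_trans[OF degree_pCons_le])
  moreover have "(x + a1) * (x + a2) * (x + 1) ^ Suc d =
    x ^ (Suc d + 2) + (a1 + a2 + of_nat (Suc d)) * x ^ (Suc d + 1) + poly ?R x" for x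
  proof -
    have "(x + a1) * (x + a2) * (x + 1) ^ Suc d = (x + 1) * ((x + a1) * (x + a2) * (x + 1) ^ d)"
      by simp
    then show ?thesis unfolding eq by (simp add: poly_monom algebra_simps)
  qed
  ultimately show ?case by blast
qed

lemma hahn_moment_continuation:
  "\<exists>g. g holomorphic_on hahn_domain a1 a2 \<and>
     (\<forall>c\<in>hahn_domain a1 a2. real k < Re (c - a1 - a2) \<longrightarrow>
        (\<lambda>x. of_nat x ^ k * hahn_weight a1 a2 c x) sums g c)"
proof (induction k rule: less_induct)
  case (less k)
  show ?case
  proof (cases k)
    case 0
    have "(\<lambda>x. hahn_weight a1 a2 c x) sums (\<Sum>x. hahn_weight a1 a2 c x)"
      if "c \<in> hahn_domain a1 a2" for c
      using hahn_moment_summable[OF that, of 0] that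
      by (intro summable_sums) (auto simp: hahn_domain_def)
    then show ?thesis using hahn_mass_holomorphic unfolding 0 power_0 mult_1 by blast
  next
    case (Suc d)
    have "\<forall>i\<in>{..d}. \<exists>g. g holomorphic_on hahn_domain a1 a2 \<and>
     (\<forall>c\<in>hahn_domain a1 a2. real i < Re (c - a1 - a2) \<longrightarrow>
        (\<lambda>x. of_nat x ^ i * hahn_weight a1 a2 c x) sums g c)"
      using less Suc by auto
    then obtain G where G: "\<And>i. i \<le> d \<Longrightarrow> G i holomorphic_on hahn_domain a1 a2"
      "\<And>i c. i \<le> d \<Longrightarrow> c \<in> hahn_domain a1 a2 \<Longrightarrow> real i < Re (c - a1 - a2) \<Longrightarrow>
        (\<lambda>x. of_nat x ^ i * hahn_weight a1 a2 c x) sums G i c"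
      by (metis atMost_iff)
    obtain R where R: "degree R \<le> d" and eq: "\<And>x. (x + a1) * (x + a2) * (x + 1) ^ d =
      x ^ (d + 2) + (a1 + a2 + of_nat d) * x ^ (d + 1) + poly R x"
      using hahn_moment_reduction by blast
    have Rx: "poly R x = (\<Sum>i\<le>d. coeff R i * x ^ i)" for x
      unfolding poly_altdef using R by (intro sum.mono_neutral_left) (auto simp: coeff_eq_0)
    let ?g = "\<lambda>c. (\<Sum>i\<le>d. coeff R i * G i c) / (c - a1 - a2 - of_nat d)"
    have nz: "c - a1 - a2 - of_nat d \<noteq> 0" if "c \<in> hahn_domain a1 a2" for c
      using that unfolding hahn_domain_def by (cases d) (auto simp del: of_nat_Suc)
    have "?g holomorphic_on hahn_domain a1 a2"
      using G(1) nz by (intro holomorphic_intros) auto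
    moreover have "(\<lambda>x. of_nat x ^ k * hahn_weight a1 a2 c x) sums ?g c"
      if c: "c \<in> hahn_domain a1 a2" and k: "real k < Re (c - a1 - a2)" for c
    proof -
      let ?w = "hahn_weight a1 a2 c"
      define T where "T x = of_nat x * (of_nat x + c) * of_nat x ^ d * ?w x" for x
      have T_eq: "T x = of_nat x ^ (d + 2) * ?w x + c * (of_nat x ^ (d + 1) * ?w x)" for x
        by (simp add: T_def algebra_simps)
      have lim: "(\<lambda>x. of_nat x ^ (d + 2) * ?w x) \<longlonglongrightarrow> 0"
        "(\<lambda>x. of_nat x ^ (d + 1) * ?w x) \<longlonglongrightarrow> 0"
        by (rule hahn_moment_tendsto_0[OF c], use k Suc in simp)+
      have "T \<longlonglongrightarrow> 0"
        unfolding T_eq using tendsto_add[OF lim(1) tendsto_mult_right_zero[OF lim(2)]] by simp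
      then have tel: "(\<lambda>x. T (Suc x) - T x) sums 0"
        using telescope_sums[of T 0] by (simp add: T_def)
      have T_Suc: "T (Suc x) - T x = poly R (of_nat x) * ?w x -
          (c - a1 - a2 - of_nat d) * (of_nat x ^ k * ?w x)" for x
      proof -
        have "T (Suc x) = (of_nat (Suc x) * (of_nat (Suc x) + c) * ?w (Suc x)) * (of_nat x + 1) ^ d"
          by (simp add: T_def algebra_simps)
        also have "\<dots> = ((of_nat x + a1) * (of_nat x + a2) * (of_nat x + 1) ^ d) * ?w x"
          unfolding hahn_weight_Suc[OF c] by (simp add: algebra_simps)
        finally show ?thesis unfolding eq T_eq Suc by (simp add: algebra_simps)
      qed
      have "(\<lambda>x. \<Sum>i\<le>d. coeff R i * (of_nat x ^ i * ?w x)) sums (\<Sum>i\<le>d. coeff R i * G i c)"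
        using k Suc c by (intro sums_sum sums_mult G(2)) auto
      then have "(\<lambda>x. poly R (of_nat x) * ?w x) sums (\<Sum>i\<le>d. coeff R i * G i c)"
        by (simp add: Rx sum_distrib_right mult.assoc)
      from sums_diff[OF this tel]
      have "(\<lambda>x. (c - a1 - a2 - of_nat d) * (of_nat x ^ k * ?w x)) sums (\<Sum>i\<le>d. coeff R i * G i c)"
        unfolding T_Suc by simp
      from sums_divide[OF this, of "c - a1 - a2 - of_nat d"] show ?thesis
        using nz[OF c] by simp
    qed
    ultimately show ?thesis by blast
  qed
qed

lemma hahn_continuation_exists: "\<exists>g. hahn_continuation a1 a2 f g"
proof -
  obtain G where G: "\<And>i. G i holomorphic_on hahn_domain a1 a2"
    "\<And>i c. c \<in> hahn_domain a1 a2 \<Longrightarrow> real i < Re (c - a1 - a2) \<Longrightarrow>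
      (\<lambda>x. of_nat x ^ i * hahn_weight a1 a2 c x) sums G i c"
    using hahn_moment_continuation[of a1 a2] by metis
  let ?g = "\<lambda>c. \<Sum>i\<le>degree f. coeff f i * G i c"
  have "?g holomorphic_on hahn_domain a1 a2"
    by (intro holomorphic_intros G)
  moreover have "(\<lambda>x. poly f (of_nat x) * hahn_weight a1 a2 c x) sums ?g c"
    if c: "c \<in> hahn_domain a1 a2" "real (degree f) < Re (c - a1 - a2)" for c
  proof -
    have "(\<lambda>x. \<Sum>i\<le>degree f. coeff f i * (of_nat x ^ i * hahn_weight a1 a2 c x)) sums ?g c"
      using c by (intro sums_sum sums_mult G(2)) auto
    then show ?thesis by (simp add: poly_altdef sum_distrib_right mult.assoc)
  qed
  ultimately show ?thesis unfolding hahn_continuation_def by blast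
qed

lemma hahn_continuation_unique:
  assumes g: "hahn_continuation a1 a2 f g" and h: "hahn_continuation a1 a2 f h"
    and b: "b \<in> hahn_domain a1 a2"
  shows "g b = h b"
proof -
  let ?S = "hahn_domain a1 a2 \<inter> {c. real (degree f) < Re (c - a1 - a2)}"
  have op: "open ?S"
    by (intro open_Int open_hahn_domain open_Collect_less continuous_intros)
  obtain m :: nat where m: "\<bar>Re (a1 + a2)\<bar> < real m" using reals_Archimedean2 by blast
  define c where "c = a1 + a2 + of_real (real (degree f) + real m + 1 / 2)"
  have "c - a1 - a2 \<noteq> of_nat (Suc k)" for k
  proof
    assume "c - a1 - a2 = of_nat (Suc k)"
    then have "Re (c - a1 - a2) = real (Suc k)" by simp
    then have "2 * (degree f + m) + 1 = 2 * Suc k" unfolding c_def by (simp add: field_simps)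
    then show False by presburger
  qed
  moreover have "c \<noteq> - of_nat (Suc k)" for k
  proof
    assume "c = - of_nat (Suc k)"
    then have "Re c = - real (Suc k)" by simp
    then show False using m unfolding c_def by auto
  qed
  ultimately have "c \<in> ?S" unfolding hahn_domain_def by (auto simp: c_def)
  then have ne: "?S \<noteq> {}" by blast
  have eq: "g z = h z" if "z \<in> ?S" for z
    using that g h unfolding hahn_continuation_def by (blast intro: sums_unique2)
  have "g holomorphic_on hahn_domain a1 a2" "h holomorphic_on hahn_domain a1 a2"
    using g h unfolding hahn_continuation_def by blast+
  from analytic_continuation_open[OF op open_hahn_domain ne connected_hahn_domain Int_lower1 this eq b]
  show ?thesis .
qed

theorem hahn_functional_eqI:
  assumes "hahn_continuation a1 a2 f g" "b \<in> hahn_domain a1 a2"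
  shows "hahn_functional a1 a2 b f = g b"
  unfolding hahn_functional_def
proof (rule the_equality)
  show "\<exists>g'. hahn_continuation a1 a2 f g' \<and> g b = g' b" using assms by blast
  show "v = g b" if "\<exists>g'. hahn_continuation a1 a2 f g' \<and> v = g' b" for v
    using that hahn_continuation_unique[OF _ assms] by blast
qed

theorem hahn_functional_continuation: "hahn_continuation a1 a2 f (\<lambda>b. hahn_functional a1 a2 b f)"
proof -
  obtain g where g: "hahn_continuation a1 a2 f g" using hahn_continuation_exists by blast
  have eq: "hahn_functional a1 a2 c f = g c" if "c \<in> hahn_domain a1 a2" for c
    using hahn_functional_eqI[OF g that] .
  have "(\<lambda>b. hahn_functional a1 a2 b f) holomorphic_on hahn_domain a1 a2"
    using g eq holomorphic_transform[of g] unfolding hahn_continuation_def by metis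
  then show ?thesis using g eq unfolding hahn_continuation_def by simp
qed

corollary hahn_functional_eq_suminf:
  assumes "b \<in> hahn_domain a1 a2" "real (degree f) < Re (b - a1 - a2)"
  shows "hahn_functional a1 a2 b f = (\<Sum>x. poly f (of_nat x) * hahn_weight a1 a2 b x)"
  using hahn_functional_continuation assms unfolding hahn_continuation_def
  by (blast intro: sums_unique)

definition monic_orthogonal ::
  "(complex poly \<Rightarrow> complex) \<Rightarrow> (nat \<Rightarrow> complex poly) \<Rightarrow> (nat \<Rightarrow> complex) \<Rightarrow> bool" where
  "monic_orthogonal L P h \<longleftrightarrow>
     (\<forall>n. degree (P n) = n \<and> lead_coeff (P n) = 1) \<and>
     (\<forall>n m. L (P n * P m) = (if n = m then h n else 0)) \<and>
     (\<forall>n. h n \<noteq> 0)"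

text \<open>The term for \<open>n = 0\<close> is dropped because \<open>P\<close> has index \<open>- 1\<close> there, where it is \<open>0\<close>.\<close>

definition recurrence_coefficients ::
  "(nat \<Rightarrow> complex poly) \<Rightarrow> (nat \<Rightarrow> complex) \<Rightarrow> (nat \<Rightarrow> complex) \<Rightarrow> bool" where
  "recurrence_coefficients P \<beta> \<gamma> \<longleftrightarrow> \<gamma> 0 = 0 \<and>
     (\<forall>n. [:0, 1:] * P n =
        P (Suc n) + smult (\<beta> n) (P n) + (if n = 0 then 0 else smult (\<gamma> n) (P (n - 1))))"

end

theory Submission
  imports Defs
begin

text \<open>
  Summation by parts gives the Pearson equation
  \<open>L[x (x + b) f(x - 1)] = L[(x + a1) (x + a2) f(x)]\<close>, first for the convergent series and then for
  its continuation. Hence the operator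
  \<open>D f = (x + a1) (x + a2) (f(x + 1) - f(x)) - x (x + b) (f(x) - f(x - 1))\<close> is symmetric with respect
  to \<open>L\<close>; as it does not raise degrees, \<open>P n\<close> is an eigenvector of \<open>D\<close>, with eigenvalue
  \<open>n (n - 1 - (b - a1 - a2))\<close>. On the coefficients \<open>(\<Delta>\<^sup>k f)(0)\<close> in Newton's forward difference
  formula, \<open>D\<close> acts by a two-term rule, which yields the first three coefficients of \<open>P n\<close>.
  Comparing them in the three-term recurrence gives \<open>\<beta> n\<close> and \<open>\<gamma> n\<close>.
\<close>

section \<open>Forward and backward differences and Newton coefficients of polynomials\<close>

definition fdiff :: "'a::comm_ring_1 poly \<Rightarrow> 'a poly" where
  "fdiff f = pcompose f [:1, 1:] - f"

definition bdiff :: "'a::comm_ring_1 poly \<Rightarrow> 'a poly" where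
  "bdiff f = f - pcompose f [:-1, 1:]"

text \<open>The coefficient at the binomial polynomial x(x-1)...(x-k+1)/k!. Leaving out the division
  by k! makes sense over every commutative ring; in return, factors \<open>fact k\<close> accompany
  leading coefficients.\<close>

definition newton :: "nat \<Rightarrow> 'a::comm_ring_1 poly \<Rightarrow> 'a" where
  "newton k f = poly ((fdiff ^^ k) f) 0"

lemma fdiff_add: "fdiff (f + g) = fdiff f + fdiff g"
  by (simp add: fdiff_def pcompose_add)

lemma fdiff_smult: "fdiff (smult c f) = smult c (fdiff f)"
  by (simp add: fdiff_def pcompose_smult smult_diff_right)

lemma funpow_fdiff_add: "(fdiff ^^ k) (f + g) = (fdiff ^^ k) f + (fdiff ^^ k) g"
  by (induction k) (simp_all add: fdiff_add)

lemma funpow_fdiff_smult: "(fdiff ^^ k) (smult c f) = smult c ((fdiff ^^ k) f)"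
  by (induction k) (simp_all add: fdiff_smult)

lemma newton_add: "newton k (f + g) = newton k f + newton k g"
  by (simp add: newton_def funpow_fdiff_add)

lemma newton_smult: "newton k (smult c f) = c * newton k f"
  by (simp add: newton_def funpow_fdiff_smult)

lemma newton_0: "newton k 0 = 0"
  using newton_smult[of k 0 0] by simp

lemma newton_diff: "newton k (f - g) = newton k f - newton k g"
  using newton_add[of k f "smult (-1) g"] newton_smult[of k "-1" g] by simp

lemma newton_fdiff: "newton k (fdiff f) = newton (Suc k) f"
  by (simp add: newton_def funpow_swap1)

lemma funpow_fdiff_shift: "(fdiff ^^ k) (pcompose f [:1, 1:]) = pcompose ((fdiff ^^ k) f) [:1, 1:]"
  by (induction k) (simp_all add: fdiff_def pcompose_diff)

lemma fdiff_mult_X: "fdiff ([:0, 1:] * f) = [:0, 1:] * fdiff f + pcompose f [:1, 1:]"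
  by (simp add: fdiff_def pcompose_pCons algebra_simps)

text \<open>Leibniz rule: \<Delta>x = 1 and the higher differences of x vanish, so only two terms
  survive.\<close>

lemma funpow_fdiff_mult_X: "(fdiff ^^ Suc k) ([:0, 1:] * f) =
    [:0, 1:] * (fdiff ^^ Suc k) f + smult (of_nat (Suc k)) (pcompose ((fdiff ^^ k) f) [:1, 1:])"
proof (induction k)
  case 0
  show ?case using fdiff_mult_X[of f] by simp
next
  case (Suc k)
  let ?g = "(fdiff ^^ Suc k) f"
  have "fdiff (pcompose ((fdiff ^^ k) f) [:1, 1:]) = pcompose ?g [:1, 1:]"
    by (simp add: fdiff_def pcompose_diff)
  then have "(fdiff ^^ Suc (Suc k)) ([:0, 1:] * f) =
      ([:0, 1:] * fdiff ?g + pcompose ?g [:1, 1:]) + smult (of_nat (Suc k)) (pcompose ?g [:1, 1:])"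
    unfolding funpow.simps(2)[of "Suc k" fdiff] o_apply Suc.IH fdiff_add fdiff_smult fdiff_mult_X
    by simp
  also have "\<dots> = [:0, 1:] * fdiff ?g + smult (of_nat (Suc (Suc k))) (pcompose ?g [:1, 1:])"
    unfolding of_nat_Suc[of "Suc k"] smult_add_left smult_1_left by (simp only: add_ac)
  finally show ?case by simp
qed

text \<open>At 0 only the shifted term of the Leibniz rule remains, and the shift is 1 + \<Delta>.
  For \<open>k = 0\<close> the truncated \<open>k - 1\<close> is harmless because of the factor
  \<open>of_nat k\<close>.\<close>

lemma newton_mult_X: "newton k ([:0, 1:] * f) = of_nat k * (newton k f + newton (k - 1) f)"
proof (cases k)
  case 0
  then show ?thesis by (simp add: newton_def)
next
  case (Suc j)
  have "poly (pcompose ((fdiff ^^ j) f) [:1, 1:]) 0 = newton (Suc j) f + newton j f"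
    by (simp add: newton_def fdiff_def)
  then show ?thesis unfolding Suc newton_def funpow_fdiff_mult_X by (simp add: newton_def)
qed

lemma shift_bdiff: "pcompose (bdiff f) [:1, 1:] = fdiff f"
  by (simp add: bdiff_def fdiff_def pcompose_diff flip: pcompose_assoc)
    (simp add: pcompose_pCons)

text \<open>The shift in the Leibniz rule turns \<nabla> into \<Delta>. In other words, the binomial
  polynomials are eigenvectors of x\<nabla>.\<close>

lemma newton_mult_X_bdiff: "newton k ([:0, 1:] * bdiff f) = of_nat k * newton k f"
proof (cases k)
  case 0
  then show ?thesis by (simp add: newton_def)
next
  case (Suc j)
  have "poly (pcompose ((fdiff ^^ j) (bdiff f)) [:1, 1:]) 0 = newton (Suc j) f"
    unfolding funpow_fdiff_shift[symmetric] shift_bdiff newton_fdiff[symmetric]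
    by (simp add: newton_def)
  then show ?thesis unfolding Suc newton_def funpow_fdiff_mult_X by (simp add: newton_def)
qed

lemma newton_mult_linear:
  "newton k ([:c, 1:] * f) = (of_nat k + c) * newton k f + of_nat k * newton (k - 1) f"
proof -
  have eq: "[:c, 1:] * f = [:0, 1:] * f + smult c f" by simp
  show ?thesis unfolding eq newton_add newton_smult newton_mult_X by (simp add: algebra_simps)
qed

text \<open>Induction along \<Delta>(c + x p) = x \<Delta>p + \<Delta>p + p: the coefficient at x^k
  receives k times \<open>coeff p k\<close> from the first summand and once more from the last. A
  bound on the degree, instead of its exact value, lets the result be iterated.\<close>

lemma fdiff_degree_coeff:
  fixes f :: "'a::comm_ring_1 poly"
  assumes "degree f \<le> Suc k"
  shows "degree (fdiff f) \<le> k" "coeff (fdiff f) k = of_nat (Suc k) * coeff f (Suc k)"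
proof -
  have "degree (fdiff f) \<le> k \<and> coeff (fdiff f) k = of_nat (Suc k) * coeff f (Suc k)"
    using assms
  proof (induction f arbitrary: k)
    case 0
    then show ?case by (simp add: fdiff_def)
  next
    case (pCons c p)
    have eq: "fdiff (pCons c p) = pCons 0 (fdiff p) + fdiff p + p"
      by (simp add: fdiff_def pcompose_pCons algebra_simps)
    have p: "degree p \<le> k" using pCons.prems pCons.hyps by (cases "p = 0") auto
    show ?case
    proof (cases k)
      case 0
      then obtain d where "p = [:d:]" using p degree_eq_zeroE by blast
      then show ?thesis unfolding eq using 0 by (simp add: fdiff_def)
    next
      case (Suc j)
      note IH = pCons.IH[of j]
      have "degree (fdiff p) \<le> j" "coeff (fdiff p) j = of_nat (Suc j) * coeff p (Suc j)"
        using IH p Suc by blast+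
      then show ?thesis unfolding eq using Suc p
        by (auto intro!: degree_add_le simp: coeff_eq_0 algebra_simps
            intro: order_trans[OF degree_pCons_le])
    qed
  qed
  then show "degree (fdiff f) \<le> k" "coeff (fdiff f) k = of_nat (Suc k) * coeff f (Suc k)" by auto
qed

lemma newton_top:
  fixes f :: "'a::{comm_ring_1, ring_char_0} poly"
  shows "degree f \<le> n \<Longrightarrow> newton n f = fact n * coeff f n"
proof (induction n arbitrary: f)
  case 0
  then show ?case by (simp add: newton_def poly_0_coeff_0)
next
  case (Suc n)
  show ?case
    using Suc.IH[OF fdiff_degree_coeff(1)[OF Suc.prems]] fdiff_degree_coeff(2)[OF Suc.prems]
    by (simp add: newton_fdiff algebra_simps)
qed

lemma newton_eq_0:
  fixes f :: "'a::{comm_ring_1, ring_char_0} poly"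
  shows "degree f < n \<Longrightarrow> newton n f = 0"
  using newton_top[of f n] by (simp add: coeff_eq_0)

text \<open>The Newton coefficient at the degree is a nonzero multiple of the leading
  coefficient.\<close>

lemma degree_le_newton:
  fixes f :: "'a::{idom, ring_char_0} poly"
  assumes "\<And>k. n < k \<Longrightarrow> newton k f = 0"
  shows "degree f \<le> n"
proof (rule ccontr)
  assume "\<not> degree f \<le> n"
  then have "newton (degree f) f = 0" "f \<noteq> 0" using assms by auto
  then show False using newton_top[of f "degree f"] by simp
qed

section \<open>The second-order difference operator of the Hahn weight\<close>

definition hahn_operator :: "complex \<Rightarrow> complex \<Rightarrow> complex \<Rightarrow> complex poly \<Rightarrow> complex poly" where
  "hahn_operator a1 a2 b f = [:a1, 1:] * ([:a2, 1:] * fdiff f) - [:b, 1:] * ([:0, 1:] * bdiff f)"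

definition hahn_eigenvalue :: "complex \<Rightarrow> complex \<Rightarrow> complex \<Rightarrow> nat \<Rightarrow> complex" where
  "hahn_eigenvalue a1 a2 b n = of_nat n * (of_nat n - 1 - (b - a1 - a2))"

text \<open>Both products contribute k(k-1) times the coefficient of index k - 1, and these terms
  cancel. What is left is upper bidiagonal.\<close>

lemma newton_hahn_operator:
  "newton k (hahn_operator a1 a2 b f) =
     hahn_eigenvalue a1 a2 b k * newton k f + (of_nat k + a1) * (of_nat k + a2) * newton (Suc k) f"
  unfolding hahn_operator_def newton_diff newton_mult_linear[of _ b] newton_mult_X_bdiff
    newton_mult_linear[of _ a1] newton_mult_linear[of _ a2] newton_fdiff hahn_eigenvalue_def
  \<comment> \<open>The cases 0, 1 and n + 2 resolve the truncated subtractions \<open>k - 1\<close>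
    and \<open>k - 1 - 1\<close>.\<close>
  by (induction k rule: induct_nat_012) (simp_all add: algebra_simps)

text \<open>Each of the two products may raise the degree by one; the two-term rule shows that this
  cancels.\<close>

lemma degree_hahn_operator: "degree (hahn_operator a1 a2 b f) \<le> degree f"
  by (rule degree_le_newton) (simp add: newton_hahn_operator newton_eq_0)

section \<open>Orthogonal polynomials of a linear functional with a Pearson equation\<close>

text \<open>The algebra needs only linearity and the Pearson equation at one fixed \<open>b\<close>,
  which keeps convergence and continuation out of it.\<close>

locale pearson_functional =
  fixes a1 a2 b :: complex and L :: "complex poly \<Rightarrow> complex"
  assumes L_add: "L (f + g) = L f + L g"
    and L_smult: "L (smult c f) = c * L f"
    and pearson: "L ([:0, 1:] * [:b, 1:] * pcompose f [:-1, 1:]) = L ([:a1, 1:] * [:a2, 1:] * f)"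
begin

lemma L_diff: "L (f - g) = L f - L g"
  using L_add[of f "smult (-1) g"] L_smult[of "-1" g] by simp

text \<open>A discrete Green formula, whose right-hand side is symmetric in \<open>f\<close> and
  \<open>g\<close>.\<close>

lemma L_hahn_operator:
  "L (g * hahn_operator a1 a2 b f) = - L ([:a1, 1:] * [:a2, 1:] * (fdiff g * fdiff f))"
proof -
  \<comment> \<open>Chosen so that its backward shift is g \<nabla>f: the Pearson equation then
    rewrites the second half of the operator.\<close>
  let ?F = "pcompose g [:1, 1:] * fdiff f"
  have F: "pcompose ?F [:-1, 1:] = g * bdiff f"
    by (simp add: bdiff_def fdiff_def pcompose_diff pcompose_mult flip: pcompose_assoc)
      (simp add: pcompose_pCons)
  have "g * hahn_operator a1 a2 b f =
      [:a1, 1:] * [:a2, 1:] * (g * fdiff f) - [:0, 1:] * [:b, 1:] * (g * bdiff f)"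
    unfolding hahn_operator_def by (simp only: algebra_simps)
  then have "L (g * hahn_operator a1 a2 b f) =
      L ([:a1, 1:] * [:a2, 1:] * (g * fdiff f)) - L ([:a1, 1:] * [:a2, 1:] * ?F)"
    using pearson[of ?F] unfolding F by (simp add: L_diff)
  also have "\<dots> = - L ([:a1, 1:] * [:a2, 1:] * ?F - [:a1, 1:] * [:a2, 1:] * (g * fdiff f))"
    by (simp add: L_diff)
  also have "[:a1, 1:] * [:a2, 1:] * ?F - [:a1, 1:] * [:a2, 1:] * (g * fdiff f) =
      [:a1, 1:] * [:a2, 1:] * (fdiff g * fdiff f)"
    unfolding fdiff_def[of g] by (simp only: algebra_simps)
  finally show ?thesis .
qed

lemma L_hahn_operator_sym:
  "L (g * hahn_operator a1 a2 b f) = L (hahn_operator a1 a2 b g * f)"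
  using L_hahn_operator[of g f] L_hahn_operator[of f g] by (simp add: mult.commute)

text \<open>The top term of \<open>f\<close> is peeled off with a multiple of
  \<open>P (Suc m)\<close>. Using \<open>coeff f m\<close> allows \<open>f\<close> to have degree
  below \<open>m\<close>.\<close>

lemma orthogonal_lower:
  assumes orth: "monic_orthogonal L P h" and f: "degree f \<le> m" and m: "m \<le> n"
  shows "L (f * P n) = (if m = n then coeff f m * h n else 0)"
  using f m
proof (induction m arbitrary: f)
  case 0
  have "degree (P 0) = 0" "lead_coeff (P 0) = 1" using orth unfolding monic_orthogonal_def by blast+
  then have P0: "P 0 = 1" by (auto elim: degree_eq_zeroE)
  obtain c where "f = [:c:]" using 0 degree_eq_zeroE by blast
  then have "f * P n = smult c (P 0 * P n)" by (simp add: P0)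
  then have "L (f * P n) = c * L (P 0 * P n)" by (simp add: L_smult)
  then show ?case using orth \<open>f = [:c:]\<close> unfolding monic_orthogonal_def by auto
next
  case (Suc m)
  let ?c = "coeff f (Suc m)"
  let ?g = "f - smult ?c (P (Suc m))"
  have P: "degree (P (Suc m)) = Suc m" "coeff (P (Suc m)) (Suc m) = 1"
    using orth unfolding monic_orthogonal_def by metis+
  have "degree ?g \<le> m"
  proof (rule degree_le, intro allI impI)
    fix i assume i: "m < i"
    show "coeff ?g i = 0"
    proof (cases "i = Suc m")
      case False
      then have "Suc m < i" using i by simp
      then show ?thesis using P Suc.prems(1) by (simp add: coeff_eq_0)
    qed (simp add: P)
  qed
  then have "L (?g * P n) = 0" using Suc.IH[of ?g] Suc.prems by simp
  moreover have "f * P n = ?g * P n + smult ?c (P (Suc m) * P n)"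
    by (simp add: algebra_simps)
  ultimately have "L (f * P n) = ?c * L (P (Suc m) * P n)" by (metis L_add L_smult add_0)
  then show ?case using orth unfolding monic_orthogonal_def by auto
qed

text \<open>A nonzero defect \<open>R\<close> would have degree m < n and be orthogonal to
  \<open>P m\<close>, but that pairing is its leading coefficient times \<open>h m\<close>, which is
  nonzero.\<close>

lemma hahn_operator_eigen:
  assumes orth: "monic_orthogonal L P h"
  shows "hahn_operator a1 a2 b (P n) = smult (hahn_eigenvalue a1 a2 b n) (P n)"
proof (rule ccontr)
  let ?D = "hahn_operator a1 a2 b"
  define R where "R = ?D (P n) - smult (hahn_eigenvalue a1 a2 b n) (P n)"
  let ?m = "degree R"
  assume "?D (P n) \<noteq> smult (hahn_eigenvalue a1 a2 b n) (P n)"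
  then have R0: "R \<noteq> 0" by (simp add: R_def)
  have P: "degree (P k) = k" for k using orth unfolding monic_orthogonal_def by metis
  have Rn: "?m \<le> n"
    using degree_hahn_operator[of a1 a2 b "P n"] P[of n] unfolding R_def
    by (intro degree_diff_le) (auto intro: order_trans[OF degree_smult_le])
  \<comment> \<open>The eigenvalue is the diagonal entry of index n, so the top coefficients
    cancel.\<close>
  have "newton n R = 0"
    by (simp add: R_def newton_diff newton_smult newton_hahn_operator newton_eq_0 P)
  then have "coeff R n = 0" using newton_top[OF Rn] by simp
  then have Rm: "?m < n" using Rn R0 by (metis le_neq_implies_less leading_coeff_0_iff)
  \<comment> \<open>By symmetry the operator may act on \<open>P ?m\<close> instead, where it stays
    within degree \<open>?m < n\<close>.\<close>
  have "L (?D (P ?m) * P n) = 0" "L (P ?m * P n) = 0"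
    using orthogonal_lower[OF orth, of "?D (P ?m)" ?m n] orthogonal_lower[OF orth, of "P ?m" ?m n]
      degree_hahn_operator[of a1 a2 b "P ?m"] P Rm by simp_all
  moreover have "P ?m * R =
      P ?m * ?D (P n) - smult (hahn_eigenvalue a1 a2 b n) (P ?m * P n)"
    by (simp add: R_def right_diff_distrib)
  ultimately have "L (P ?m * R) = 0"
    by (simp add: L_diff L_smult L_hahn_operator_sym)
  moreover have "L (R * P ?m) = lead_coeff R * h ?m"
    using orthogonal_lower[OF orth, of R ?m ?m] by simp
  moreover have "h ?m \<noteq> 0" using orth unfolding monic_orthogonal_def by blast
  ultimately show False using R0 by (simp add: mult.commute)
qed

text \<open>The eigenvector equation at index k, with the difference of two eigenvalues factored.
  When b - a1 - a2 is not an integer, it determines the coefficients below the top one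
  downwards.\<close>

lemma newton_orthogonal:
  assumes orth: "monic_orthogonal L P h"
  shows "(of_nat n - of_nat k) * (of_nat n + of_nat k - 1 - (b - a1 - a2)) * newton k (P n) =
    (of_nat k + a1) * (of_nat k + a2) * newton (Suc k) (P n)"
proof -
  have "(of_nat n - of_nat k) * (of_nat n + of_nat k - 1 - (b - a1 - a2)) =
      hahn_eigenvalue a1 a2 b n - hahn_eigenvalue a1 a2 b k"
    unfolding hahn_eigenvalue_def by (simp add: algebra_simps)
  then show ?thesis using newton_hahn_operator[of k a1 a2 b "P n"]
    unfolding hahn_operator_eigen[OF orth] newton_smult by (simp add: left_diff_distrib)
qed

end

section \<open>Linearity and Pearson equation of the continued functional\<close>

text \<open>Identity theorem: the domain is connected, and its part with
  \<open>real d < Re (c - a1 - a2)\<close> is open and nonempty.\<close>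

lemma hahn_domain_identity:
  assumes g: "g holomorphic_on hahn_domain a1 a2" and h: "h holomorphic_on hahn_domain a1 a2"
    and eq: "\<And>c. c \<in> hahn_domain a1 a2 \<Longrightarrow> real d < Re (c - a1 - a2) \<Longrightarrow> g c = h c"
    and b: "b \<in> hahn_domain a1 a2"
  shows "g b = h b"
proof -
  let ?S = "hahn_domain a1 a2 \<inter> {c. real d < Re (c - a1 - a2)}"
  have op: "open ?S"
    by (intro open_Int open_hahn_domain open_Collect_less continuous_intros)
  \<comment> \<open>Both c and c - a1 - a2 get positive imaginary part, hence avoid all excluded
    integers.\<close>
  define c where "c = a1 + a2 + Complex (real d + 1) (1 + \<bar>Im (a1 + a2)\<bar>)"
  have "Im c \<noteq> 0" "Im (c - a1 - a2) \<noteq> 0" unfolding c_def by auto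
  then have "c \<noteq> - of_nat (Suc k)" "c - a1 - a2 \<noteq> of_nat (Suc k)" for k
    using complex_Im_of_nat[of "Suc k"]
    by (auto simp del: of_nat_Suc complex_Im_of_nat minus_complex.sel)
  moreover have "real d < Re (c - a1 - a2)" by (simp add: c_def)
  ultimately have "c \<in> ?S" unfolding hahn_domain_def by auto
  then have ne: "?S \<noteq> {}" by blast
  show ?thesis
    by (rule analytic_continuation_open[OF op open_hahn_domain ne connected_hahn_domain Int_lower1 g h _ b])
      (use eq in blast)
qed

lemma hahn_functional_holomorphic:
  "(\<lambda>c. hahn_functional a1 a2 c f) holomorphic_on hahn_domain a1 a2"
  using hahn_functional_continuation unfolding hahn_continuation_def by blast

text \<open>A free bound \<open>d\<close> lets several polynomials share one half-plane of
  convergence.\<close>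

lemma hahn_functional_sums:
  assumes "c \<in> hahn_domain a1 a2" "real d < Re (c - a1 - a2)" "degree f \<le> d"
  shows "(\<lambda>x. poly f (of_nat x) * hahn_weight a1 a2 c x) sums hahn_functional a1 a2 c f"
  using hahn_functional_continuation[of a1 a2 f] assms unfolding hahn_continuation_def
  by (auto dest!: bspec[of _ _ c])

lemma hahn_functional_add:
  assumes "b \<in> hahn_domain a1 a2"
  shows "hahn_functional a1 a2 b (f + g) = hahn_functional a1 a2 b f + hahn_functional a1 a2 b g"
proof (rule hahn_domain_identity[OF _ _ _ assms])
  let ?d = "max (degree f) (degree g)"
  fix c assume c: "c \<in> hahn_domain a1 a2" "real ?d < Re (c - a1 - a2)"
  from sums_add[OF hahn_functional_sums[OF c] hahn_functional_sums[OF c], of f g]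
  have "(\<lambda>x. poly (f + g) (of_nat x) * hahn_weight a1 a2 c x) sums
      (hahn_functional a1 a2 c f + hahn_functional a1 a2 c g)"
    by (simp add: algebra_simps)
  moreover have "degree (f + g) \<le> ?d" by (rule degree_add_le_max)
  ultimately show "hahn_functional a1 a2 c (f + g) = hahn_functional a1 a2 c f + hahn_functional a1 a2 c g"
    using hahn_functional_sums[OF c] sums_unique2 by blast
qed (intro holomorphic_intros hahn_functional_holomorphic)+

lemma hahn_functional_smult:
  assumes "b \<in> hahn_domain a1 a2"
  shows "hahn_functional a1 a2 b (smult t f) = t * hahn_functional a1 a2 b f"
proof (rule hahn_domain_identity[OF _ _ _ assms])
  fix c assume c: "c \<in> hahn_domain a1 a2" "real (degree f) < Re (c - a1 - a2)"
  from sums_mult[OF hahn_functional_sums[OF c], of f t]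
  have "(\<lambda>x. poly (smult t f) (of_nat x) * hahn_weight a1 a2 c x) sums (t * hahn_functional a1 a2 c f)"
    by (simp add: algebra_simps)
  then show "hahn_functional a1 a2 c (smult t f) = t * hahn_functional a1 a2 c f"
    using hahn_functional_sums[OF c degree_smult_le] sums_unique2 by blast
qed (intro holomorphic_intros hahn_functional_holomorphic)+

text \<open>For convergent series this is an index shift combined with the recurrence of the weight;
  the identity theorem carries it to the whole domain.\<close>

lemma hahn_functional_pearson:
  assumes b: "b \<in> hahn_domain a1 a2"
  shows "hahn_functional a1 a2 b ([:0, 1:] * [:b, 1:] * pcompose f [:-1, 1:]) =
    hahn_functional a1 a2 b ([:a1, 1:] * [:a2, 1:] * f)"
proof -
  let ?f = "pcompose f [:-1, 1:]"
  let ?l = "\<lambda>c. hahn_functional a1 a2 c ([:0, 1:] * [:c, 1:] * ?f)"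
  let ?r = "\<lambda>c. hahn_functional a1 a2 c ([:a1, 1:] * [:a2, 1:] * f)"
  \<comment> \<open>Holomorphy is known for fixed polynomials only, so the parameter inside
    \<open>[:c, 1:]\<close> is moved out as a scalar.\<close>
  let ?l' = "\<lambda>c. hahn_functional a1 a2 c ([:0, 1:] * [:0, 1:] * ?f) +
    c * hahn_functional a1 a2 c ([:0, 1:] * ?f)"
  have l: "?l c = ?l' c" if "c \<in> hahn_domain a1 a2" for c
  proof -
    have "[:0, 1:] * [:c, 1:] * ?f = [:0, 1:] * [:0, 1:] * ?f + smult c ([:0, 1:] * ?f)"
      by (simp add: algebra_simps)
    then show ?thesis using that by (simp only: hahn_functional_add hahn_functional_smult)
  qed
  have "?l' b = ?r b"
  proof (rule hahn_domain_identity[OF _ _ _ b])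
    let ?d = "degree f + 2"
    fix c assume c: "c \<in> hahn_domain a1 a2" "real ?d < Re (c - a1 - a2)"
    let ?w = "hahn_weight a1 a2 c"
    let ?T = "\<lambda>x. poly ([:0, 1:] * [:c, 1:] * ?f) (of_nat x) * ?w x"
    have "degree ([:0, 1:] * [:c, 1:] * ?f) \<le> 1 + 1 + degree f"
      by (intro order_trans[OF degree_mult_le] add_mono) (auto simp: degree_pcompose)
    then have "?T sums ?l c" by (intro hahn_functional_sums[OF c]) simp
    \<comment> \<open>The term at 0 vanishes because of the factor x.\<close>
    then have "(\<lambda>x. ?T (Suc x)) sums ?l c" by (subst sums_Suc_iff) simp
    moreover have "?T (Suc x) = poly ([:a1, 1:] * [:a2, 1:] * f) (of_nat x) * ?w x" for x
    proof -
      have "?T (Suc x) = (of_nat (Suc x) * (of_nat (Suc x) + c) * ?w (Suc x)) * poly f (of_nat x)"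
        by (simp add: poly_pcompose algebra_simps)
      then show ?thesis unfolding hahn_weight_Suc[OF c(1)] by (simp add: algebra_simps)
    qed
    ultimately have "(\<lambda>x. poly ([:a1, 1:] * [:a2, 1:] * f) (of_nat x) * ?w x) sums ?l c" by simp
    moreover have "degree ([:a1, 1:] * [:a2, 1:] * f) \<le> 1 + 1 + degree f"
      by (intro order_trans[OF degree_mult_le] add_mono) auto
    then have "(\<lambda>x. poly ([:a1, 1:] * [:a2, 1:] * f) (of_nat x) * ?w x) sums ?r c"
      by (intro hahn_functional_sums[OF c]) simp
    ultimately show "?l' c = ?r c" using l[OF c(1)] sums_unique2 by metis
  qed (intro holomorphic_intros hahn_functional_holomorphic)+
  then show ?thesis using l[OF b] by simp
qed

section \<open>Rational identities behind the closed forms\<close>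

lemma hahn_beta_identity:
  fixes n a1 a2 b :: complex
  assumes "2 * n + a1 + a2 - b \<noteq> 0" "2 * n + a1 + a2 - b - 2 \<noteq> 0"
  shows "n * (1 + (n - 1 + a1) * (n - 1 + a2) / (2 * n + a1 + a2 - b - 2))
      - (n + 1) * (n + a1) * (n + a2) / (2 * n + a1 + a2 - b) =
    ((b + 2 - a1 - a2) * a1 * a2 - n * (a1 + a2 + b) * (n + a1 + a2 - b - 1))
      / ((2 * n + a1 + a2 - b) * (2 * n + a1 + a2 - b - 2))"
proof -
  \<comment> \<open>Eliminating \<open>b\<close> in favour of \<open>D\<close> leaves
    \<open>D\<close> and \<open>D - 2\<close> as the only denominators.\<close>
  define D where "D = 2 * n + a1 + a2 - b"
  have b: "b = 2 * n + a1 + a2 - D" by (simp add: D_def)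
  have "D \<noteq> 0" "D - 2 \<noteq> 0" using assms by (simp_all add: D_def)
  then have "n * (1 + (n - 1 + a1) * (n - 1 + a2) / (D - 2)) - (n + 1) * (n + a1) * (n + a2) / D =
    ((b + 2 - a1 - a2) * a1 * a2 - n * (a1 + a2 + b) * (n + a1 + a2 - b - 1)) / (D * (D - 2))"
    unfolding b by (simp add: divide_simps) algebra
  then show ?thesis by (simp add: D_def)
qed

lemma hahn_gamma_identity:
  fixes n a1 a2 b \<beta> :: complex
  defines "D \<equiv> 2 * n + a1 + a2 - b"
  assumes "D \<noteq> 0" "D - 1 \<noteq> 0" "D - 2 \<noteq> 0" "D - 3 \<noteq> 0"
    and \<beta>: "\<beta> = n * (1 + (n - 1 + a1) * (n - 1 + a2) / (D - 2)) - (n + 1) * (n + a1) * (n + a2) / D"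
  shows "n * (n - 1 + a1) * (n - 1 + a2) / (D - 2) *
      (n - 1 + (n - 1) * (n - 2 + a1) * (n - 2 + a2) / (2 * (D - 3))
        - \<beta>) - (n + 1) * n * (n + a1) * (n + a2) * (n - 1 + a1) * (n - 1 + a2) / (2 * (D - 1) * D) =
      - n * ((n + a1 - 1) * (n + a2 - 1) * (n + a1 - b - 1) / ((D - 1) * (D - 3))) *
      ((n + a2 - b - 1) * (n + a1 + a2 - b - 2) / (D - 2) ^ 2)"
proof -
  have b: "b = 2 * n + a1 + a2 - D" by (simp add: D_def)
  \<comment> \<open>The common factor n(n-1+a1)(n-1+a2)/(D-2) is split off first, which leaves a
    smaller polynomial identity.\<close>
  have "(n - 1 + (n - 1) * (n - 2 + a1) * (n - 2 + a2) / (2 * (D - 3)) - \<beta>)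
      - (n + 1) * (n + a1) * (n + a2) * (D - 2) / (2 * (D - 1) * D) =
    - (n + a1 - b - 1) * (n + a2 - b - 1) * (n + a1 + a2 - b - 2) / ((D - 1) * (D - 3) * (D - 2))" (is "?x = ?y")
    unfolding \<beta> b using assms(2-5) by (simp add: divide_simps) algebra
  then have "n * (n - 1 + a1) * (n - 1 + a2) / (D - 2) * ?x = n * (n - 1 + a1) * (n - 1 + a2) / (D - 2) * ?y"
    by simp
  then show ?thesis using assms(2-5) by (simp add: divide_simps) algebra
qed

section \<open>Recurrence coefficients from the top Newton coefficients\<close>

theorem proposition5:
  fixes a1 a2 b :: complex
    and P :: "nat \<Rightarrow> complex poly"
    and h \<beta> \<gamma> :: "nat \<Rightarrow> complex"
  assumes b: "\<And>k::nat. k \<ge> 1 \<Longrightarrow> b \<noteq> - of_nat k"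
    and Re_pos: "Re (b - a1 - a2) > 0"
    and not_nat: "\<And>k::nat. k \<ge> 1 \<Longrightarrow> b - a1 - a2 \<noteq> of_nat k"
    and orth: "monic_orthogonal (hahn_functional a1 a2 b) P h"
    and rec: "recurrence_coefficients P \<beta> \<gamma>"
  shows "\<forall>n::nat. \<beta> n =
      ((b + 2 - a1 - a2) * a1 * a2
        - of_nat n * (a1 + a2 + b) * (of_nat n + a1 + a2 - b - 1))
      / ((2 * of_nat n + a1 + a2 - b) * (2 * of_nat n + a1 + a2 - b - 2))
    \<and> \<gamma> n =
      - of_nat n *
      ((of_nat n + a1 - 1) * (of_nat n + a2 - 1) * (of_nat n + a1 - b - 1)
        / ((2 * of_nat n + a1 + a2 - b - 1) * (2 * of_nat n + a1 + a2 - b - 3))) *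
      ((of_nat n + a2 - b - 1) * (of_nat n + a1 + a2 - b - 2)
        / (2 * of_nat n + a1 + a2 - b - 2) ^ 2)"
proof
  fix n
  define s where "s = b - a1 - a2"
  have dom: "b \<in> hahn_domain a1 a2"
    using b Re_pos not_nat unfolding hahn_domain_def by (auto simp del: of_nat_Suc)
  interpret pearson_functional a1 a2 b "hahn_functional a1 a2 b"
    using dom by unfold_locales
      (simp_all only: hahn_functional_add hahn_functional_smult hahn_functional_pearson)
  \<comment> \<open>The positive real part excludes the integers up to 0, \<open>not_nat\<close> the
    others. Hence D = 2n - s is not an integer either, and no denominator vanishes.\<close>
  have s: "s \<noteq> of_int i" for i
  proof
    assume i: "s = of_int i"
    then have "i > 0" using Re_pos by (simp add: s_def)
    then have "s = of_nat (nat i)" "nat i \<ge> 1" using i by auto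
    then show False using not_nat unfolding s_def by blast
  qed
  have P: "degree (P k) = k" "coeff (P k) k = 1" for k
    using orth unfolding monic_orthogonal_def by metis+
  have top: "newton k (P k) = fact k" for k
    using newton_top[of "P k" k] P[of k] by simp
  define D where "D = 2 * of_nat n + a1 + a2 - b"
  have D: "D \<noteq> of_int i" for i
    using s[of "2 * int n - i"] unfolding D_def s_def by (auto simp: algebra_simps)
  have D0: "D \<noteq> 0" "D - 1 \<noteq> 0" "D - 2 \<noteq> 0" "D - 3 \<noteq> 0"
    using D[of 0] D[of 1] D[of 2] D[of 3] by simp_all
  \<comment> \<open>The factor \<open>of_nat k\<close> on both sides covers k = 0, where
    \<open>k - 1\<close> is truncated.\<close>
  have first: "of_nat k * newton (k - 1) (P k) =
      fact k * (of_nat k * (of_nat k - 1 + a1) * (of_nat k - 1 + a2) / (2 * of_nat k - 2 - s))" for k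
  proof (cases k)
    case (Suc m)
    have "2 * of_nat m - s \<noteq> 0" using s[of "2 * int m"] by auto
    moreover have "(2 * of_nat m - s) * newton m (P (Suc m)) =
        (of_nat m + a1) * (of_nat m + a2) * fact (Suc m)"
      using newton_orthogonal[OF orth, of "Suc m" m] top[of "Suc m"] unfolding s_def[symmetric]
      by simp
    ultimately show ?thesis unfolding Suc by (simp add: field_simps)
  qed simp
  have rec_newton: "of_nat k * (newton k (P m) + newton (k - 1) (P m)) =
      newton k (P (Suc m)) + \<beta> m * newton k (P m) +
      (if m = 0 then 0 else \<gamma> m * newton k (P (m - 1)))" for k m
  proof -
    have "[:0, 1:] * P m =
        P (Suc m) + smult (\<beta> m) (P m) + (if m = 0 then 0 else smult (\<gamma> m) (P (m - 1)))"
      using rec unfolding recurrence_coefficients_def by blast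
    from arg_cong[OF this, of "newton k"] show ?thesis
      unfolding newton_mult_X by (auto simp: newton_add newton_smult newton_0 split: if_splits)
  qed
  have \<beta>: "\<beta> n = of_nat n * (1 + (of_nat n - 1 + a1) * (of_nat n - 1 + a2) / (D - 2)) -
      (of_nat n + 1) * (of_nat n + a1) * (of_nat n + a2) / D"
  proof -
    \<comment> \<open>At index n the \<gamma> term drops out, since \<open>P (n - 1)\<close> has
      smaller degree.\<close>
    have "of_nat n * (newton n (P n) + newton (n - 1) (P n)) =
        newton n (P (Suc n)) + \<beta> n * newton n (P n)"
      using rec_newton[of n n] P by (auto simp: newton_eq_0)
    moreover have "newton n (P (Suc n)) =
        fact n * ((of_nat n + 1) * (of_nat n + a1) * (of_nat n + a2) / D)"
    proof -
      have "of_nat (Suc n) * newton n (P (Suc n)) = of_nat (Suc n) *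
          (fact n * ((of_nat n + 1) * (of_nat n + a1) * (of_nat n + a2) / D))"
        using first[of "Suc n"] by (simp add: D_def s_def algebra_simps)
      then show ?thesis unfolding mult_cancel_left of_nat_eq_0_iff by simp
    qed
    moreover have "2 * of_nat n - 2 - s = D - 2" by (simp add: D_def s_def)
    ultimately have "fact n * \<beta> n = fact n *
        (of_nat n * (1 + (of_nat n - 1 + a1) * (of_nat n - 1 + a2) / (D - 2)) -
         (of_nat n + 1) * (of_nat n + a1) * (of_nat n + a2) / D)"
      unfolding top distrib_left[of "of_nat n"] first[of n] by (simp add: algebra_simps)
    then show ?thesis unfolding mult_cancel_left by simp
  qed
  have \<gamma>: "\<gamma> n = of_nat n * (of_nat n - 1 + a1) * (of_nat n - 1 + a2) / (D - 2) *
      (of_nat n - 1 + (of_nat n - 1) * (of_nat n - 2 + a1) * (of_nat n - 2 + a2) / (2 * (D - 3)) - \<beta> n) -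
      (of_nat n + 1) * of_nat n * (of_nat n + a1) * (of_nat n + a2) *
      (of_nat n - 1 + a1) * (of_nat n - 1 + a2) / (2 * (D - 1) * D)"
  proof (cases n)
    case 0
    then show ?thesis using rec unfolding recurrence_coefficients_def by simp
  next
    case (Suc m)
    define x :: complex where "x = of_nat m"
    have n: "of_nat n = x + 1" by (simp add: x_def Suc)
    have D: "D = 2 * x + 2 - s" by (simp add: D_def s_def n)
    \<comment> \<open>With m = n - 1 and up to the factor m!, u is the second Newton coefficient of
      \<open>P n\<close>, u v is m times the third, and w is the third of
      \<open>P (Suc n)\<close>.\<close>
    define u v w where "u = (x + 1) * (x + a1) * (x + a2) / (D - 2)"
      and "v = x * (x - 1 + a1) * (x - 1 + a2) / (2 * (D - 3))"
      and "w = (x + 1 + 1) * (x + 1) * (x + 1 + a1) * (x + 1 + a2) * (x + a1) * (x + a2) / (2 * (D - 1) * D)"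
    have A: "newton m (P n) = fact m * u"
    proof -
      have "(D - 2) * newton m (P n) = (x + a1) * (x + a2) * (fact m * (x + 1))"
        using newton_orthogonal[OF orth, of n m] top[of n] unfolding D s_def[symmetric] n
        by (simp add: Suc x_def[symmetric] algebra_simps)
      then have "newton m (P n) = (x + a1) * (x + a2) * (fact m * (x + 1)) / (D - 2)"
        using D0 by (simp add: nonzero_eq_divide_eq mult.commute)
      then show ?thesis by (simp add: u_def mult_ac)
    qed
    have B: "x * newton (m - 1) (P n) = v * newton m (P n)"
    proof (cases m)
      case 0
      then show ?thesis by (simp add: v_def x_def)
    next
      case l: (Suc l)
      have xl: "of_nat l = x - 1" by (simp add: x_def l)
      have eq: "(x + 1 - (x - 1)) * (x + 1 + (x - 1) - 1 - s) = 2 * (D - 3)" by (simp add: D)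
      have "2 * (D - 3) * newton l (P n) = (x - 1 + a1) * (x - 1 + a2) * newton m (P n)"
        using newton_orthogonal[OF orth, of n l] unfolding s_def[symmetric] n xl eq
        unfolding l .
      then have "newton l (P n) = (x - 1 + a1) * (x - 1 + a2) * newton m (P n) / (2 * (D - 3))"
        using D0 by (simp add: nonzero_eq_divide_eq mult.commute)
      then show ?thesis by (simp add: v_def l)
    qed
    have C: "newton m (P (Suc n)) = fact m * w"
    proof -
      have sn: "of_nat (Suc n) = x + 2" by (simp add: n)
      have eq1: "(x + 2 - x) * (x + 2 + x - 1 - s) = 2 * (D - 1)" by (simp add: D)
      have eq2: "(x + 2 - (x + 1)) * (x + 2 + (x + 1) - 1 - s) = D" by (simp add: D)
      have 1: "2 * (D - 1) * newton m (P (Suc n)) = (x + a1) * (x + a2) * newton n (P (Suc n))"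
        using newton_orthogonal[OF orth, of "Suc n" m]
        unfolding s_def[symmetric] sn x_def[symmetric] Suc[symmetric] eq1 .
      have top': "newton (Suc n) (P (Suc n)) = (x + 1 + 1) * (x + 1) * fact m"
        unfolding top using n by (simp add: Suc x_def[symmetric] mult_ac add_ac)
      have "D * newton n (P (Suc n)) =
          (x + 1 + a1) * (x + 1 + a2) * ((x + 1 + 1) * (x + 1) * fact m)"
        using newton_orthogonal[OF orth, of "Suc n" n] unfolding s_def[symmetric] sn n eq2 top' .
      then have 2: "newton n (P (Suc n)) =
          (x + 1 + a1) * (x + 1 + a2) * ((x + 1 + 1) * (x + 1) * fact m) / D"
        using D0 by (simp add: nonzero_eq_divide_eq mult.commute)
      from 1 have "newton m (P (Suc n)) = (x + a1) * (x + a2) * newton n (P (Suc n)) / (2 * (D - 1))"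
        using D0 by (simp add: nonzero_eq_divide_eq mult.commute)
      then show ?thesis unfolding 2 w_def by (simp add: mult_ac)
    qed
    \<comment> \<open>At index m = n - 1 the \<gamma> term enters with the top coefficient m! of
      \<open>P (n - 1)\<close>.\<close>
    have "x * newton m (P n) + x * newton (m - 1) (P n) =
        newton m (P (Suc n)) + \<beta> n * newton m (P n) + \<gamma> n * fact m"
      using rec_newton[of m n] top[of m] by (simp add: Suc x_def distrib_left)
    then have "fact m * \<gamma> n = fact m * (u * (x + v - \<beta> n) - w)"
      unfolding B C A by (simp add: algebra_simps)
    then have "\<gamma> n = u * (x + v - \<beta> n) - w" unfolding mult_cancel_left by simp
    moreover have "x + 1 - 1 = x" "x + 1 - 2 = x - 1" by simp_all
    ultimately show ?thesis unfolding n u_def v_def w_def by (simp only:)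
  qed
  show "\<beta> n =
      ((b + 2 - a1 - a2) * a1 * a2
        - of_nat n * (a1 + a2 + b) * (of_nat n + a1 + a2 - b - 1))
      / ((2 * of_nat n + a1 + a2 - b) * (2 * of_nat n + a1 + a2 - b - 2))
    \<and> \<gamma> n =
      - of_nat n *
      ((of_nat n + a1 - 1) * (of_nat n + a2 - 1) * (of_nat n + a1 - b - 1)
        / ((2 * of_nat n + a1 + a2 - b - 1) * (2 * of_nat n + a1 + a2 - b - 3))) *
      ((of_nat n + a2 - b - 1) * (of_nat n + a1 + a2 - b - 2)
        / (2 * of_nat n + a1 + a2 - b - 2) ^ 2)"
    using hahn_beta_identity[of "of_nat n" a1 a2 b] D0 \<beta>
      hahn_gamma_identity[of "of_nat n" a1 a2 b "\<beta> n"] \<gamma>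
    unfolding D_def by simp
qed

end
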